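(* Let $\mu$ be a positive measure on $\mathbb{D}$. Suppose that $H$ is a Hilbert space of analytic functions over $\mathbb{D}$ with a reproducing kernel $k(z,w)$ such that for any $z\in\mathbb{D}$ the function $k(z,\cdot)$ is continuous on $\overline{\mathbb{D}}$. Let $$T_{k,\mu}f(z)=\int_{\mathbb{D}}f(w)k(z,w)\,d\mu(w),\qquad f\in L^2(\mathbb{D},\mu),$$ and $$T_{\mathrm{Re}(k),\mu}f(z)=\int_{\mathbb{D}}f(w)\,\mathrm{Re}(k)(z,w)\,d\mu(w),\qquad f\in L^2(\mathbb{D},\mu),$$ where $\mathrm{Re}(k)$ denotes the real part of $k$. Then the following conditions are equivalent: (a) $T_{\mathrm{Re}(k),\mu}:L^2(\mathbb{D},\mu)\to L^2(\mathbb{D},\mu)$ is bounded. (b) $T_{k,\mu}:L^2(\mathbb{D},\mu)\to L^2(\mathbb{D},\mu)$ is bounded. (c) $\mu$ is an $H$-Carleson measure, that is, there exists a constant $c$ such that $\|f\|_{L^2(\mathbb{D},\mu)}\le c\|f\|_H$ for all $f\in H$. Moreover, whenever the equivalent conditions (a), (b), (c) hold, $$\|T_{\mathrm{Re}(k),\mu}\|_{L^2(\mathbb{D},\mu)\to L^2(\mathbb{D},\mu)}\le\|T_{k,\mu}\|_{L^2(\mathbb{D},\mu)\to L^2(\mathbb{D},\mu)}\le 2\|T_{\mathrm{Re}(k),\mu}\|_{L^2(\mathbb{D},\mu)\to L^2(\mathbb{D},\mu)}.$$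
   Context: $\mathbb{D}$ is the open unit disk in $\mathbb{C}$ and $\overline{\mathbb{D}}$ its closure. $L^2(\mathbb{D},\mu)$ consists of complex-valued functions. That $k(z,\cdot)$ is continuous on $\overline{\mathbb{D}}$ means that it extends continuously from $\mathbb{D}$ to $\overline{\mathbb{D}}$.
   Formalization: The positive measure μ is assumed to be a σ-finite Borel measure; for arbitrary positive measures the claim fails, e.g. μ = ∞·δ_0 with H the Hardy space H², where (a) and (b) hold trivially but (c) fails for f = 1. *)

theory Defs
  imports "HOL-Analysis.Analysis"
begin

abbreviation unit_disk :: "complex set"
  where "unit_disk \<equiv> ball 0 1"

text \<open>
  The complex space \<open>L\<^sup>2(M)\<close>, represented by functions rather than by classes of
  almost everywhere equal functions; \<open>L2_norm\<close> is a seminorm on it.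
\<close>

definition L2 :: "'a measure \<Rightarrow> ('a \<Rightarrow> complex) set" where
  "L2 M = {f \<in> borel_measurable M. integrable M (\<lambda>x. (cmod (f x))\<^sup>2)}"

definition L2_norm :: "'a measure \<Rightarrow> ('a \<Rightarrow> complex) \<Rightarrow> real" where
  "L2_norm M f = sqrt (\<integral>x. (cmod (f x))\<^sup>2 \<partial>M)"

definition integral_op :: "'a measure \<Rightarrow> ('a \<Rightarrow> 'a \<Rightarrow> complex) \<Rightarrow> ('a \<Rightarrow> complex) \<Rightarrow> 'a \<Rightarrow> complex" where
  "integral_op M K f = (\<lambda>z. \<integral>w. f w * K z w \<partial>M)"

text \<open>
  The integrability and membership conditions are explicit because the Bochner integral of a
  non-integrable function is \<open>0\<close>: a bounded operator on \<open>L\<^sup>2(M)\<close> has to be given by convergent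
  integrals for every \<open>f\<close> and has to map into \<open>L\<^sup>2(M)\<close>.
\<close>

definition integral_op_bounded :: "'a measure \<Rightarrow> ('a \<Rightarrow> 'a \<Rightarrow> complex) \<Rightarrow> bool" where
  "integral_op_bounded M K \<longleftrightarrow>
     (\<forall>f\<in>L2 M. (\<forall>z\<in>space M. integrable M (\<lambda>w. f w * K z w)) \<and> integral_op M K f \<in> L2 M) \<and>
     (\<exists>C. \<forall>f\<in>L2 M. L2_norm M (integral_op M K f) \<le> C * L2_norm M f)"

text \<open>The supremum is meaningful only if the operator is bounded.\<close>

definition L2_opnorm :: "'a measure \<Rightarrow> (('a \<Rightarrow> complex) \<Rightarrow> 'a \<Rightarrow> complex) \<Rightarrow> real" where
  "L2_opnorm M T = (SUP f\<in>{f \<in> L2 M. L2_norm M f \<le> 1}. L2_norm M (T f))"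

definition ip_norm :: "('v \<Rightarrow> 'v \<Rightarrow> complex) \<Rightarrow> 'v \<Rightarrow> real" where
  "ip_norm ip f = sqrt (Re (ip f f))"

text \<open>
  A complex Hilbert space \<open>H\<close> of analytic functions on the unit disk with inner product \<open>ip\<close>,
  linear in its first argument.  Functions on the disk are represented by total functions that
  vanish outside it, so that equality in \<open>H\<close> is equality on the disk.  Only the values of \<open>ip\<close> on
  \<open>H\<close> matter.
\<close>

locale analytic_hilbert_space =
  fixes H :: "(complex \<Rightarrow> complex) set"
    and ip :: "(complex \<Rightarrow> complex) \<Rightarrow> (complex \<Rightarrow> complex) \<Rightarrow> complex"
  assumes analytic: "f \<in> H \<Longrightarrow> f holomorphic_on unit_disk"
    and support: "f \<in> H \<Longrightarrow> z \<notin> unit_disk \<Longrightarrow> f z = 0"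
    and zero_mem: "(\<lambda>z. 0) \<in> H"
    and add_mem: "f \<in> H \<Longrightarrow> g \<in> H \<Longrightarrow> (\<lambda>z. f z + g z) \<in> H"
    and scale_mem: "f \<in> H \<Longrightarrow> (\<lambda>z. c * f z) \<in> H"
    and ip_add: "f \<in> H \<Longrightarrow> g \<in> H \<Longrightarrow> h \<in> H \<Longrightarrow> ip (\<lambda>z. f z + g z) h = ip f h + ip g h"
    and ip_scale: "f \<in> H \<Longrightarrow> g \<in> H \<Longrightarrow> ip (\<lambda>z. c * f z) g = c * ip f g"
    and ip_commute: "f \<in> H \<Longrightarrow> g \<in> H \<Longrightarrow> ip g f = cnj (ip f g)"
    and ip_nonneg: "f \<in> H \<Longrightarrow> 0 \<le> Re (ip f f)"
    and ip_definite: "f \<in> H \<Longrightarrow> ip f f = 0 \<Longrightarrow> f = (\<lambda>z. 0)"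
    and complete:
      "(\<And>n. F n \<in> H) \<Longrightarrow>
       (\<And>e. e > 0 \<Longrightarrow> \<exists>N. \<forall>m\<ge>N. \<forall>n\<ge>N. ip_norm ip (\<lambda>z. F m z - F n z) < e) \<Longrightarrow>
       \<exists>f\<in>H. (\<lambda>n. ip_norm ip (\<lambda>z. F n z - f z)) \<longlonglongrightarrow> 0"

text \<open>
  The convention is \<open>k(z,w) = k\<^sub>w(z)\<close>, where \<open>k\<^sub>w \<in> H\<close> represents evaluation at \<open>w\<close>.  Values of \<open>k\<close>
  outside the disk are irrelevant.
\<close>

locale analytic_rkhs = analytic_hilbert_space +
  fixes k :: "complex \<Rightarrow> complex \<Rightarrow> complex"
  assumes kernel_mem:
      "w \<in> unit_disk \<Longrightarrow> (\<lambda>z. if z \<in> unit_disk then k z w else 0) \<in> H"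
    and reproducing:
      "f \<in> H \<Longrightarrow> w \<in> unit_disk \<Longrightarrow> f w = ip f (\<lambda>z. if z \<in> unit_disk then k z w else 0)"

definition carleson_measure ::
    "(complex \<Rightarrow> complex) set \<Rightarrow> ((complex \<Rightarrow> complex) \<Rightarrow> (complex \<Rightarrow> complex) \<Rightarrow> complex)
      \<Rightarrow> complex measure \<Rightarrow> bool" where
  "carleson_measure H ip \<mu> \<longleftrightarrow> (\<exists>c. \<forall>f\<in>H. f \<in> L2 \<mu> \<and> L2_norm \<mu> f \<le> c * ip_norm ip f)"

definition Re_kernel :: "('a \<Rightarrow> 'a \<Rightarrow> complex) \<Rightarrow> 'a \<Rightarrow> 'a \<Rightarrow> complex" where
  "Re_kernel k z w = complex_of_real (Re (k z w))"

end

theory Submission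
  imports Defs
begin

text \<open>
  The Carleson embedding \<open>J : H \<rightarrow> L\<^sup>2(\<mu>)\<close> satisfies \<open>J J\<^sup>* = T\<^sub>k\<close>, which gives (c) \<open>\<Longrightarrow>\<close> (b) with
  \<open>\<parallel>T\<^sub>k\<parallel> \<le> c\<^sup>2\<close>, and (b) \<open>\<Longrightarrow>\<close> (a) holds because \<open>T\<close> for the kernel \<open>Re k\<close> is the average of \<open>T\<^sub>k\<close> and its
  conjugate.  For (a) \<open>\<Longrightarrow>\<close> (c), let \<open>A\<close> be the norm of the operator with kernel \<open>Re k\<close>.  For real \<open>p\<close>,
  supported on a set of finite measure where evaluations are uniformly bounded on the unit ball
  of \<open>H\<close>, Riesz' theorem yields \<open>u \<in> H\<close> with \<open>\<langle>h, u\<rangle> = \<integral> h p d\<mu>\<close>; then \<open>u = T\<^sub>k p\<close> and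
  \<open>\<parallel>u\<parallel>\<^sup>2 = \<integral> u p d\<mu> = \<integral> (Re u) p d\<mu> \<le> A \<parallel>p\<parallel>\<^sup>2\<close>, so no Fubini argument is needed.  Taking for \<open>p\<close> the
  restrictions of \<open>Re h\<close> and \<open>Im h\<close> and exhausting the disk by such sets gives \<open>\<parallel>h\<parallel>\<^sup>2 \<le> 2 A \<parallel>h\<parallel>\<^sub>H\<^sup>2\<close>
  in \<open>L\<^sup>2(\<mu>)\<close>, and hence also \<open>\<parallel>T\<^sub>k\<parallel> \<le> 2 A\<close>.
\<close>

text \<open>For \<open>a > 0\<close> the minimum over \<open>t\<close> sits at
  \<open>- b / a\<close> and equals \<open>c - b^2 / a\<close>; for \<open>a = 0\<close> a
  nonnegative affine function is constant. This gives Cauchy-Schwarz both in \<open>L2 M\<close> and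
  in \<open>H\<close> and, with \<open>c = 0\<close>, the first-order condition in the Riesz
  theorem.\<close>

lemma discriminant_le_of_nonneg:
  fixes a b c :: real
  assumes nonneg: "\<And>t. 0 \<le> a * t\<^sup>2 + 2 * b * t + c" and "0 \<le> a"
  shows "b\<^sup>2 \<le> a * c"
proof (cases "a = 0")
  case True
  have "b = 0"
  proof (rule ccontr)
    assume "b \<noteq> 0"
    \<comment> \<open>At this \<open>t\<close> the affine function takes the value -1.\<close>
    then show False
      using nonneg[of "- (c + 1) / (2 * b)"] True by (simp add: field_simps)
  qed
  then show ?thesis using True by simp
next
  case False
  with \<open>0 \<le> a\<close> have "0 < a" by simp
  have "0 \<le> a * (- b / a)\<^sup>2 + 2 * b * (- b / a) + c" by (rule nonneg)
  also have "\<dots> = c - b\<^sup>2 / a"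
    using \<open>0 < a\<close> by (simp add: field_simps power2_eq_square)
  finally show ?thesis using \<open>0 < a\<close> by (simp add: field_simps)
qed

subsection \<open>The space \<open>L\<^sup>2\<close>\<close>

lemma L2_measurable [measurable_dest]: "f \<in> L2 M \<Longrightarrow> f \<in> borel_measurable M"
  by (simp add: L2_def)

lemma L2_integrable_sq: "f \<in> L2 M \<Longrightarrow> integrable M (\<lambda>x. (cmod (f x))\<^sup>2)"
  by (simp add: L2_def)

lemma L2_norm_nonneg: "0 \<le> L2_norm M f"
  by (simp add: L2_norm_def)

lemma L2_norm_sq: "(L2_norm M f)\<^sup>2 = (\<integral>x. (cmod (f x))\<^sup>2 \<partial>M)"
  by (simp add: L2_norm_def)

text \<open>Operator images are identified with other functions, such as members of
  \<open>H\<close>, only at points of \<open>space M\<close>, so membership in \<open>L2 M\<close>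
  has to be insensitive to values elsewhere.\<close>

lemma L2_cong: "(\<And>x. x \<in> space M \<Longrightarrow> f x = g x) \<Longrightarrow> f \<in> L2 M \<longleftrightarrow> g \<in> L2 M"
  unfolding L2_def by (simp cong: measurable_cong Bochner_Integration.integrable_cong)

lemma L2_norm_cong: "(\<And>x. x \<in> space M \<Longrightarrow> f x = g x) \<Longrightarrow> L2_norm M f = L2_norm M g"
  unfolding L2_norm_def by (simp cong: Bochner_Integration.integral_cong)

lemma L2_integrable_norm_mult:
  assumes f: "f \<in> L2 M" and g: "g \<in> L2 M"
  shows "integrable M (\<lambda>x. cmod (f x) * cmod (g x))"
proof (rule Bochner_Integration.integrable_bound)
  show "integrable M (\<lambda>x. (cmod (f x))\<^sup>2 + (cmod (g x))\<^sup>2)"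
    using f g by (intro Bochner_Integration.integrable_add L2_integrable_sq)
  show "(\<lambda>x. cmod (f x) * cmod (g x)) \<in> borel_measurable M"
    using f g by (auto dest!: L2_measurable)
  show "AE x in M. norm (cmod (f x) * cmod (g x)) \<le> norm ((cmod (f x))\<^sup>2 + (cmod (g x))\<^sup>2)"
  proof (rule AE_I2)
    fix x
    have "2 * (cmod (f x) * cmod (g x)) \<le> (cmod (f x))\<^sup>2 + (cmod (g x))\<^sup>2"
      using sum_squares_bound[of "cmod (f x)" "cmod (g x)"] by simp
    moreover have "0 \<le> cmod (f x) * cmod (g x)" by simp
    ultimately show "norm (cmod (f x) * cmod (g x)) \<le> norm ((cmod (f x))\<^sup>2 + (cmod (g x))\<^sup>2)"
      unfolding real_norm_def by linarith
  qed
qed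

lemma L2_integrable_mult:
  assumes "f \<in> L2 M" and "g \<in> L2 M"
  shows "integrable M (\<lambda>x. f x * g x)"
  using L2_integrable_norm_mult[OF assms] assms
  by (subst integrable_norm_iff[symmetric]) (auto simp: norm_mult dest!: L2_measurable)

text \<open>The quadratic in \<open>t\<close> is the integral of (|f| t + |g|)^2. The version with
  moduli inside the integral is what the triangle inequality uses.\<close>

lemma L2_Cauchy_Schwarz_norm:
  assumes f: "f \<in> L2 M" and g: "g \<in> L2 M"
  shows "(\<integral>x. cmod (f x) * cmod (g x) \<partial>M) \<le> L2_norm M f * L2_norm M g"
proof -
  let ?b = "\<integral>x. cmod (f x) * cmod (g x) \<partial>M"
  have "?b\<^sup>2 \<le> (L2_norm M f)\<^sup>2 * (L2_norm M g)\<^sup>2"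
  proof (rule discriminant_le_of_nonneg)
    fix t :: real
    have "0 \<le> (\<integral>x. (cmod (f x) * t + cmod (g x))\<^sup>2 \<partial>M)" by simp
    also have "\<dots> = (\<integral>x. (cmod (f x))\<^sup>2 * t\<^sup>2 + (cmod (f x) * cmod (g x)) * (2 * t) + (cmod (g x))\<^sup>2 \<partial>M)"
      by (simp add: power2_sum power_mult_distrib algebra_simps)
    also have "\<dots> = (L2_norm M f)\<^sup>2 * t\<^sup>2 + 2 * ?b * t + (L2_norm M g)\<^sup>2"
      unfolding L2_norm_sq using f g
      by (simp add: L2_integrable_sq L2_integrable_norm_mult)
    finally show "0 \<le> (L2_norm M f)\<^sup>2 * t\<^sup>2 + 2 * ?b * t + (L2_norm M g)\<^sup>2" .
  qed simp
  then show ?thesis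
    by (metis L2_norm_nonneg mult_nonneg_nonneg power2_le_imp_le power_mult_distrib)
qed

lemma L2_Cauchy_Schwarz:
  assumes "f \<in> L2 M" and "g \<in> L2 M"
  shows "cmod (\<integral>x. f x * g x \<partial>M) \<le> L2_norm M f * L2_norm M g"
proof -
  have "cmod (\<integral>x. f x * g x \<partial>M) \<le> (\<integral>x. cmod (f x) * cmod (g x) \<partial>M)"
    using integral_norm_bound[of M "\<lambda>x. f x * g x"] by (simp add: norm_mult)
  then show ?thesis using L2_Cauchy_Schwarz_norm[OF assms] by linarith
qed

lemma L2_add:
  assumes f: "f \<in> L2 M" and g: "g \<in> L2 M"
  shows "(\<lambda>x. f x + g x) \<in> L2 M"
proof -
  have "integrable M (\<lambda>x. (cmod (f x + g x))\<^sup>2)"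
  proof (rule Bochner_Integration.integrable_bound)
    show "integrable M (\<lambda>x. (cmod (f x))\<^sup>2 + 2 * (cmod (f x) * cmod (g x)) + (cmod (g x))\<^sup>2)"
      using f g by (simp add: L2_integrable_sq L2_integrable_norm_mult)
    show "(\<lambda>x. (cmod (f x + g x))\<^sup>2) \<in> borel_measurable M"
      using f g by (auto dest!: L2_measurable)
    show "AE x in M. norm ((cmod (f x + g x))\<^sup>2)
        \<le> norm ((cmod (f x))\<^sup>2 + 2 * (cmod (f x) * cmod (g x)) + (cmod (g x))\<^sup>2)"
    proof (rule AE_I2)
      fix x
      have "(cmod (f x + g x))\<^sup>2 \<le> (cmod (f x) + cmod (g x))\<^sup>2"
        by (simp add: norm_triangle_ineq power_mono)
      also have "\<dots> = (cmod (f x))\<^sup>2 + 2 * (cmod (f x) * cmod (g x)) + (cmod (g x))\<^sup>2"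
        by (simp add: power2_sum)
      finally show "norm ((cmod (f x + g x))\<^sup>2)
        \<le> norm ((cmod (f x))\<^sup>2 + 2 * (cmod (f x) * cmod (g x)) + (cmod (g x))\<^sup>2)" by simp
    qed
  qed
  then show ?thesis using f g by (auto simp: L2_def)
qed

lemma L2_scale: "f \<in> L2 M \<Longrightarrow> (\<lambda>x. c * f x) \<in> L2 M"
  by (auto simp: L2_def norm_mult power_mult_distrib)

lemma L2_cnj: "f \<in> L2 M \<Longrightarrow> (\<lambda>x. cnj (f x)) \<in> L2 M"
  by (auto simp: L2_def intro: borel_measurable_continuous_on[OF continuous_on_cnj[OF continuous_on_id]])

lemma L2_norm_scale: "L2_norm M (\<lambda>x. c * f x) = cmod c * L2_norm M f"
  by (simp add: L2_norm_def norm_mult power_mult_distrib real_sqrt_mult)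

lemma L2_norm_cnj: "L2_norm M (\<lambda>x. cnj (f x)) = L2_norm M f"
  by (simp add: L2_norm_def)

lemma L2_norm_triangle:
  assumes f: "f \<in> L2 M" and g: "g \<in> L2 M"
  shows "L2_norm M (\<lambda>x. f x + g x) \<le> L2_norm M f + L2_norm M g"
proof (rule power2_le_imp_le)
  have "(L2_norm M (\<lambda>x. f x + g x))\<^sup>2
      \<le> (\<integral>x. (cmod (f x))\<^sup>2 + 2 * (cmod (f x) * cmod (g x)) + (cmod (g x))\<^sup>2 \<partial>M)"
    unfolding L2_norm_sq
  proof (rule integral_mono)
    show "(cmod (f x + g x))\<^sup>2 \<le> (cmod (f x))\<^sup>2 + 2 * (cmod (f x) * cmod (g x)) + (cmod (g x))\<^sup>2"
      for x
      using power_mono[OF norm_triangle_ineq[of "f x" "g x"], of 2] by (simp add: power2_sum)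
  qed (use f g L2_add[OF f g] in \<open>simp_all add: L2_integrable_sq L2_integrable_norm_mult\<close>)
  also have "\<dots> = (L2_norm M f)\<^sup>2 + 2 * (\<integral>x. cmod (f x) * cmod (g x) \<partial>M) + (L2_norm M g)\<^sup>2"
    unfolding L2_norm_sq using f g by (simp add: L2_integrable_sq L2_integrable_norm_mult)
  also have "\<dots> \<le> (L2_norm M f + L2_norm M g)\<^sup>2"
    using L2_Cauchy_Schwarz_norm[OF f g] by (simp add: power2_sum)
  finally show "(L2_norm M (\<lambda>x. f x + g x))\<^sup>2 \<le> (L2_norm M f + L2_norm M g)\<^sup>2" .
qed (simp add: L2_norm_nonneg)

section \<open>Operator norms of integral operators\<close>

lemma integral_op_scale: "integral_op M K (\<lambda>x. c * f x) = (\<lambda>z. c * integral_op M K f z)"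
  by (simp add: integral_op_def mult.assoc)

lemma bdd_above_L2_norm_integral_op:
  assumes "integral_op_bounded M K"
  shows "bdd_above ((\<lambda>f. L2_norm M (integral_op M K f)) ` {f \<in> L2 M. L2_norm M f \<le> 1})"
proof -
  obtain C where C: "\<And>f. f \<in> L2 M \<Longrightarrow> L2_norm M (integral_op M K f) \<le> C * L2_norm M f"
    using assms by (auto simp: integral_op_bounded_def)
  show ?thesis
  proof (rule bdd_aboveI2)
    fix g assume "g \<in> {f \<in> L2 M. L2_norm M f \<le> 1}"
    then have g: "g \<in> L2 M" "L2_norm M g \<le> 1" by auto
    have "L2_norm M (integral_op M K g) \<le> C * L2_norm M g" by (rule C) fact
    \<comment> \<open>The constant in \<open>integral_op_bounded\<close> carries no sign condition;
      only with \<open>\<bar>C\<bar>\<close> can the factor \<open>L2_norm M g \<le> 1\<close> be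
      dropped.\<close>
    also have "\<dots> \<le> \<bar>C\<bar> * L2_norm M g"
      by (intro mult_right_mono L2_norm_nonneg) simp
    also have "\<dots> \<le> \<bar>C\<bar>"
      using mult_left_mono[OF g(2), of "\<bar>C\<bar>"] by simp
    finally show "L2_norm M (integral_op M K g) \<le> \<bar>C\<bar>" .
  qed
qed

lemma L2_opnorm_nonneg:
  assumes "integral_op_bounded M K"
  shows "0 \<le> L2_opnorm M (integral_op M K)"
proof -
  have "0 \<le> L2_norm M (integral_op M K (\<lambda>x. 0))" by (rule L2_norm_nonneg)
  also have "\<dots> \<le> L2_opnorm M (integral_op M K)"
    unfolding L2_opnorm_def
    by (rule cSUP_upper[OF _ bdd_above_L2_norm_integral_op[OF assms]])
      (simp add: L2_def L2_norm_def)
  finally show ?thesis .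
qed

text \<open>Normalising \<open>f\<close> reduces the claim to the supremum. A function of seminorm 0
  cannot be normalised; there the bounding constant already forces the image to have seminorm
  0.\<close>

lemma L2_opnorm_upper:
  assumes bd: "integral_op_bounded M K" and f: "f \<in> L2 M"
  shows "L2_norm M (integral_op M K f) \<le> L2_opnorm M (integral_op M K) * L2_norm M f"
proof (cases "L2_norm M f = 0")
  case True
  obtain C where "L2_norm M (integral_op M K f) \<le> C * L2_norm M f"
    using bd f by (auto simp: integral_op_bounded_def)
  then show ?thesis using True by simp
next
  case False
  then have pos: "0 < L2_norm M f" using L2_norm_nonneg[of M f] by simp
  define c where "c = complex_of_real (1 / L2_norm M f)"
  have c: "cmod c = 1 / L2_norm M f" using pos by (simp add: c_def norm_divide)
  have "L2_norm M (integral_op M K (\<lambda>x. c * f x)) \<le> L2_opnorm M (integral_op M K)"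
    unfolding L2_opnorm_def
    by (rule cSUP_upper[OF _ bdd_above_L2_norm_integral_op[OF bd]])
      (use f pos in \<open>simp add: L2_scale L2_norm_scale c\<close>)
  then show ?thesis
    using pos by (simp add: integral_op_scale L2_norm_scale c field_simps)
qed

lemma L2_opnorm_least:
  assumes "0 \<le> B"
    and bound: "\<And>f. f \<in> L2 M \<Longrightarrow> L2_norm M (T f) \<le> B * L2_norm M f"
  shows "L2_opnorm M T \<le> B"
  unfolding L2_opnorm_def
proof (rule cSUP_least)
  have "(\<lambda>x. 0) \<in> {f \<in> L2 M. L2_norm M f \<le> 1}" by (simp add: L2_def L2_norm_def)
  then show "{f \<in> L2 M. L2_norm M f \<le> 1} \<noteq> {}" by blast
next
  fix f assume "f \<in> {f \<in> L2 M. L2_norm M f \<le> 1}"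
  then have "f \<in> L2 M" "L2_norm M f \<le> 1" by auto
  then show "L2_norm M (T f) \<le> B"
    using bound[of f] mult_left_mono[of "L2_norm M f" 1 B] \<open>0 \<le> B\<close> by simp
qed

subsection \<open>The real part of a bounded kernel\<close>

text \<open>Conjugating the kernel amounts to conjugating the argument and the result of the
  operator with kernel \<open>K\<close>. Conjugation preserves \<open>L2_norm\<close>, so the
  average of the two operators has norm at most that of the first.\<close>

lemma Re_kernel_bound:
  assumes bd: "integral_op_bounded M K"
  shows integral_op_bounded_Re: "integral_op_bounded M (Re_kernel K)"
    and L2_opnorm_Re_le: "L2_opnorm M (integral_op M (Re_kernel K)) \<le> L2_opnorm M (integral_op M K)"
proof -
  let ?T = "integral_op M K" and ?R = "integral_op M (Re_kernel K)"
  let ?B = "L2_opnorm M ?T"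
  have int: "integrable M (\<lambda>w. f w * K z w)" if "f \<in> L2 M" "z \<in> space M" for f z
    using bd that by (auto simp: integral_op_bounded_def)
  have T: "?T f \<in> L2 M" if "f \<in> L2 M" for f
    using bd that by (auto simp: integral_op_bounded_def)
  have split: "f w * Re_kernel K z w = (1/2) * (f w * K z w) + (1/2) * cnj (cnj (f w) * K z w)"
    for f :: "'a \<Rightarrow> complex" and z w
    unfolding Re_kernel_def by (simp add: complex_eq_iff field_simps)
  have intR: "integrable M (\<lambda>w. f w * Re_kernel K z w)" if f: "f \<in> L2 M" and z: "z \<in> space M" for f z
    unfolding split using int[OF f z] int[OF L2_cnj[OF f] z]
    by (intro Bochner_Integration.integrable_add integrable_mult_right integrable_cnj)
  \<comment> \<open>\<open>S f\<close> is the average on the level of functions. It is compared with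
    \<open>?R f\<close> only on \<open>space M\<close>, where the integrals are known to
    converge.\<close>
  define S where "S f = (\<lambda>z. (1/2) * ?T f z + (1/2) * cnj (?T (\<lambda>w. cnj (f w)) z))" for f
  have R: "?R f z = S f z" if f: "f \<in> L2 M" and z: "z \<in> space M" for f z
  proof -
    have "?R f z = (\<integral>w. (1/2) * (f w * K z w) \<partial>M) + (\<integral>w. (1/2) * cnj (cnj (f w) * K z w) \<partial>M)"
      unfolding integral_op_def split using int[OF f z] int[OF L2_cnj[OF f] z]
      by (intro Bochner_Integration.integral_add integrable_mult_right integrable_cnj)
    then show ?thesis
      unfolding S_def integral_op_def Bochner_Integration.integral_mult_right_zero
        Bochner_Integration.integral_cnj .
  qed
  have SL2: "S f \<in> L2 M" if "f \<in> L2 M" for f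
    unfolding S_def using that by (intro L2_add L2_scale L2_cnj T)
  have RL2: "?R f \<in> L2 M" if f: "f \<in> L2 M" for f
    using L2_cong[of M "?R f" "S f"] R[OF f] SL2[OF f] by simp
  have normR: "L2_norm M (?R f) \<le> ?B * L2_norm M f" if f: "f \<in> L2 M" for f
  proof -
    have "L2_norm M (?R f) = L2_norm M (S f)"
      by (rule L2_norm_cong[OF R[OF f]])
    also have "\<dots> \<le> L2_norm M (\<lambda>z. (1/2) * ?T f z)
        + L2_norm M (\<lambda>z. (1/2) * cnj (?T (\<lambda>w. cnj (f w)) z))"
      unfolding S_def using f by (intro L2_norm_triangle L2_scale L2_cnj T)
    also have "\<dots> = (1/2) * L2_norm M (?T f) + (1/2) * L2_norm M (?T (\<lambda>w. cnj (f w)))"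
      by (subst (1 2) L2_norm_scale) (simp add: L2_norm_cnj)
    also have "\<dots> \<le> ?B * L2_norm M f"
      using L2_opnorm_upper[OF bd f] L2_opnorm_upper[OF bd L2_cnj[OF f]]
      by (simp add: L2_norm_cnj)
    finally show ?thesis .
  qed
  show "integral_op_bounded M (Re_kernel K)"
    unfolding integral_op_bounded_def using intR RL2 normR by blast
  show "L2_opnorm M ?R \<le> ?B"
    by (rule L2_opnorm_least[OF L2_opnorm_nonneg[OF bd] normR])
qed

subsection \<open>Riesz representation\<close>

context analytic_hilbert_space
begin

section \<open>Norm identities and Cauchy-Schwarz in the Hilbert space\<close>

lemma ip_norm_nonneg: "f \<in> H \<Longrightarrow> 0 \<le> ip_norm ip f"
  by (simp add: ip_norm_def ip_nonneg)

lemma ip_norm_sq: "f \<in> H \<Longrightarrow> (ip_norm ip f)\<^sup>2 = Re (ip f f)"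
  by (simp add: ip_norm_def ip_nonneg)

lemma diff_mem: "f \<in> H \<Longrightarrow> g \<in> H \<Longrightarrow> (\<lambda>z. f z - g z) \<in> H"
  using add_mem[OF _ scale_mem[of g "-1"], of f] by simp

lemma ip_diff:
  assumes "f \<in> H" "g \<in> H" "h \<in> H"
  shows "ip (\<lambda>z. f z - g z) h = ip f h - ip g h"
  using ip_add[OF assms(1) scale_mem[OF assms(2), of "-1"] assms(3)]
    ip_scale[OF assms(2,3), of "-1"] by simp

text \<open>Linearity is assumed in the first argument; this symmetry transfers it to the second one
  for real parts and real scalars.\<close>

lemma Re_ip_commute: "f \<in> H \<Longrightarrow> g \<in> H \<Longrightarrow> Re (ip g f) = Re (ip f g)"
  using ip_commute[of f g] by simp

lemma ip_norm_add_sq: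
  assumes f: "f \<in> H" and g: "g \<in> H"
  shows "(ip_norm ip (\<lambda>z. f z + g z))\<^sup>2 = (ip_norm ip f)\<^sup>2 + 2 * Re (ip f g) + (ip_norm ip g)\<^sup>2"
proof -
  note fg = add_mem[OF f g]
  have "Re (ip (\<lambda>z. f z + g z) (\<lambda>z. f z + g z)) = Re (ip (\<lambda>z. f z + g z) f) + Re (ip (\<lambda>z. f z + g z) g)"
    using ip_add[OF f g fg] Re_ip_commute[OF f fg] Re_ip_commute[OF g fg] by simp
  then show ?thesis
    using ip_add[OF f g f] ip_add[OF f g g] Re_ip_commute[OF f g]
    by (simp add: ip_norm_sq f g fg)
qed

lemma ip_norm_scale:
  assumes f: "f \<in> H"
  shows "ip_norm ip (\<lambda>z. c * f z) = cmod c * ip_norm ip f"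
proof -
  note cf = scale_mem[OF f, of c]
  have "ip (\<lambda>z. c * f z) (\<lambda>z. c * f z) = c * cnj (c * ip f f)"
    using ip_scale[OF f cf, of c] ip_commute[OF cf f] ip_scale[OF f f, of c] by simp
  also have "\<dots> = (cmod c)\<^sup>2 * cnj (ip f f)"
    by (simp only: complex_norm_square complex_cnj_mult mult.assoc)
  finally show ?thesis
    by (simp add: ip_norm_def real_sqrt_mult del: of_real_power)
qed

lemma ip_norm_diff_sq:
  assumes f: "f \<in> H" and g: "g \<in> H"
  shows "(ip_norm ip (\<lambda>z. f z - g z))\<^sup>2 = (ip_norm ip f)\<^sup>2 - 2 * Re (ip f g) + (ip_norm ip g)\<^sup>2"
proof -
  have "Re (ip f (\<lambda>z. -1 * g z)) = - Re (ip f g)"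
    using Re_ip_commute[OF f scale_mem[OF g, of "-1"]] ip_scale[OF g f, of "-1"]
      Re_ip_commute[OF f g] by simp
  then show ?thesis
    using ip_norm_add_sq[OF f scale_mem[OF g, of "-1"]] ip_norm_scale[OF g, of "-1"] by simp
qed

text \<open>With \<open>t\<close> real the right-hand side is a quadratic polynomial in
  \<open>t\<close>, ready for \<open>discriminant_le_of_nonneg\<close>.\<close>

lemma ip_norm_add_real_scale_sq:
  assumes f: "f \<in> H" and h: "h \<in> H"
  shows "(ip_norm ip (\<lambda>z. f z + complex_of_real t * h z))\<^sup>2
    = (ip_norm ip f)\<^sup>2 + 2 * t * Re (ip f h) + t\<^sup>2 * (ip_norm ip h)\<^sup>2"
proof -
  have "Re (ip f (\<lambda>z. complex_of_real t * h z)) = t * Re (ip f h)"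
    using Re_ip_commute[OF f scale_mem[OF h, of t]] ip_scale[OF h f, of t]
      Re_ip_commute[OF f h] by simp
  then show ?thesis
    using ip_norm_add_sq[OF f scale_mem[OF h, of t]] ip_norm_scale[OF h, of t]
    by (simp add: power_mult_distrib)
qed

lemma Re_ip_Cauchy_Schwarz:
  assumes f: "f \<in> H" and g: "g \<in> H"
  shows "\<bar>Re (ip f g)\<bar> \<le> ip_norm ip f * ip_norm ip g"
proof -
  have "(Re (ip f g))\<^sup>2 \<le> (ip_norm ip g)\<^sup>2 * (ip_norm ip f)\<^sup>2"
  proof (rule discriminant_le_of_nonneg)
    show "0 \<le> (ip_norm ip g)\<^sup>2 * t\<^sup>2 + 2 * Re (ip f g) * t + (ip_norm ip f)\<^sup>2" for t
      using zero_le_power2[of "ip_norm ip (\<lambda>z. f z + complex_of_real t * g z)"]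
      unfolding ip_norm_add_real_scale_sq[OF f g] by (simp add: algebra_simps)
  qed simp
  then have "\<bar>Re (ip f g)\<bar>\<^sup>2 \<le> (ip_norm ip f * ip_norm ip g)\<^sup>2"
    by (simp add: power_mult_distrib mult.commute)
  then show ?thesis
    by (rule power2_le_imp_le) (simp add: ip_norm_nonneg f g)
qed

text \<open>Multiplying \<open>f\<close> by \<open>cnj (ip f g)\<close> makes the inner product real
  and nonnegative, so the bound for real parts applies; one factor \<open>cmod (ip f g)\<close> then
  cancels.\<close>

lemma ip_Cauchy_Schwarz:
  assumes f: "f \<in> H" and g: "g \<in> H"
  shows "cmod (ip f g) \<le> ip_norm ip f * ip_norm ip g"
proof (cases "ip f g = 0")
  case True
  then show ?thesis by (simp add: ip_norm_nonneg f g)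
next
  case False
  let ?c = "cnj (ip f g)"
  have "Re (ip (\<lambda>z. ?c * f z) g) = (cmod (ip f g))\<^sup>2"
    using ip_scale[OF f g, of ?c] complex_norm_square[of "ip f g"]
    by (metis Re_complex_of_real mult.commute)
  then have "cmod (ip f g) * cmod (ip f g) \<le> cmod (ip f g) * (ip_norm ip f * ip_norm ip g)"
    using Re_ip_Cauchy_Schwarz[OF scale_mem[OF f, of ?c] g] ip_norm_scale[OF f, of ?c]
    by (simp add: power2_eq_square)
  then show ?thesis using False by simp
qed

text \<open>The representing element minimises \<open>\<parallel>h\<parallel>\<^sup>2 - 2 Re (L h)\<close>; by the parallelogram law every
  minimising sequence is Cauchy.\<close>

lemma Riesz_representation:
  assumes add: "\<And>f g. f \<in> H \<Longrightarrow> g \<in> H \<Longrightarrow> L (\<lambda>z. f z + g z) = L f + L g"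
    and scale: "\<And>f c. f \<in> H \<Longrightarrow> L (\<lambda>z. c * f z) = c * L f"
    and bound: "\<And>f. f \<in> H \<Longrightarrow> cmod (L f) \<le> C * ip_norm ip f"
  obtains u where "u \<in> H" "\<And>f. f \<in> H \<Longrightarrow> ip f u = L f"
proof -
  define J where "J f = (ip_norm ip f)\<^sup>2 - 2 * Re (L f)" for f
  \<comment> \<open>Completing the square in \<open>ip_norm ip f\<close> bounds \<open>J\<close>
    from below, so the infimum over \<open>H\<close> is finite.\<close>
  have J_ge: "- C\<^sup>2 \<le> J f" if f: "f \<in> H" for f
  proof -
    have "Re (L f) \<le> C * ip_norm ip f"
      using bound[OF f] complex_Re_le_cmod[of "L f"] by linarith
    moreover have "0 \<le> (ip_norm ip f - C)\<^sup>2" by simp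
    ultimately show ?thesis unfolding J_def power2_diff by (simp add: algebra_simps)
  qed
  define m where "m = (INF f\<in>H. J f)"
  have bdd: "bdd_below (J ` H)" using J_ge by (rule bdd_belowI2)
  have m_le: "m \<le> J f" if "f \<in> H" for f
    unfolding m_def using bdd that by (rule cINF_lower)
  have "\<exists>f\<in>H. J f < m + 1 / real (Suc n)" for n
    using cINF_less_iff[OF _ bdd, of "m + 1 / real (Suc n)"] zero_mem
    unfolding m_def by auto
  then obtain F where FH: "\<And>n. F n \<in> H" and FJ: "\<And>n. J (F n) < m + 1 / real (Suc n)"
    by metis
  \<comment> \<open>The midpoint of \<open>F i\<close> and \<open>F j\<close> lies in
    \<open>H\<close>, so \<open>J\<close> is at least \<open>m\<close> there; the parallelogram law
    turns the excess of \<open>J (F i)\<close> and \<open>J (F j)\<close> over \<open>m\<close> into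
    a bound on the distance.\<close>
  have F_diff: "(ip_norm ip (\<lambda>z. F i z - F j z))\<^sup>2 \<le> 2 / real (Suc i) + 2 / real (Suc j)" for i j
  proof -
    let ?s = "\<lambda>z. F i z + F j z"
    have s: "?s \<in> H" by (intro add_mem FH)
    have half: "(\<lambda>z. (1/2) * ?s z) \<in> H" by (rule scale_mem[OF s])
    have "4 * J (\<lambda>z. (1/2) * ?s z) = (ip_norm ip ?s)\<^sup>2 - 4 * Re (L (F i)) - 4 * Re (L (F j))"
      unfolding J_def ip_norm_scale[OF s] scale[OF s] add[OF FH FH]
      by (simp add: power_mult_distrib power2_eq_square field_simps)
    then have "(ip_norm ip (\<lambda>z. F i z - F j z))\<^sup>2 = 2 * J (F i) + 2 * J (F j) - 4 * J (\<lambda>z. (1/2) * ?s z)"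
      unfolding ip_norm_diff_sq[OF FH FH] ip_norm_add_sq[OF FH FH] J_def[of "F i"] J_def[of "F j"]
      by simp
    then show ?thesis using m_le[OF half] FJ[of i] FJ[of j] by simp
  qed
  have "\<exists>u\<in>H. (\<lambda>n. ip_norm ip (\<lambda>z. F n z - u z)) \<longlonglongrightarrow> 0"
  proof (rule complete[OF FH])
    fix e :: real assume e: "e > 0"
    \<comment> \<open>Beyond this \<open>N\<close> each of the two terms in \<open>F_diff\<close> is
      below half of e^2.\<close>
    then obtain N where N: "4 / e\<^sup>2 < real N" using reals_Archimedean2 by blast
    show "\<exists>N. \<forall>i\<ge>N. \<forall>j\<ge>N. ip_norm ip (\<lambda>z. F i z - F j z) < e"
    proof (intro exI allI impI)
      fix i j assume "i \<ge> N" "j \<ge> N"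
      then have "4 / e\<^sup>2 < real (Suc i)" "4 / e\<^sup>2 < real (Suc j)" using N by linarith+
      then have "2 / real (Suc i) < e\<^sup>2 / 2" "2 / real (Suc j) < e\<^sup>2 / 2"
        using e by (simp_all add: field_simps del: of_nat_Suc)
      then have "(ip_norm ip (\<lambda>z. F i z - F j z))\<^sup>2 < e\<^sup>2"
        using F_diff[of i j] by linarith
      then show "ip_norm ip (\<lambda>z. F i z - F j z) < e"
        using e by (simp add: power2_less_imp_less)
    qed
  qed
  then obtain u where u: "u \<in> H" and lim: "(\<lambda>n. ip_norm ip (\<lambda>z. F n z - u z)) \<longlonglongrightarrow> 0" by blast
  have Re_eq: "Re (ip f u) = Re (L f)" if f: "f \<in> H" for f
  proof -
    have "(\<lambda>n. Re (ip (F n) f) - Re (ip u f)) \<longlonglongrightarrow> 0"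
    proof (rule tendsto_0_le[OF lim, of _ "ip_norm ip f"], rule always_eventually, rule allI)
      fix n
      show "norm (Re (ip (F n) f) - Re (ip u f))
          \<le> norm (ip_norm ip (\<lambda>z. F n z - u z)) * ip_norm ip f"
        using Re_ip_Cauchy_Schwarz[OF diff_mem[OF FH u] f, of n] ip_diff[OF FH u f, of n]
        by (simp add: ip_norm_nonneg diff_mem FH u)
    qed
    then have conv: "(\<lambda>n. Re (ip (F n) f)) \<longlonglongrightarrow> Re (ip u f)"
      by (simp add: LIM_zero_iff)
    \<comment> \<open>First-order condition: \<open>F n\<close> is perturbed by \<open>t\<close>
      times \<open>f\<close>, and its excess \<open>1 / real (Suc n)\<close> over the infimum
      vanishes in the limit. A nonnegative quadratic without constant term has no linear
      term.\<close>
    have "(Re (ip u f) - Re (L f))\<^sup>2 \<le> (ip_norm ip f)\<^sup>2 * 0"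
    proof (rule discriminant_le_of_nonneg)
      fix t :: real
      have "0 \<le> (ip_norm ip f)\<^sup>2 * t\<^sup>2 + 2 * (Re (ip (F n) f) - Re (L f)) * t + 1 / real (Suc n)" for n
      proof -
        have "J (\<lambda>z. F n z + complex_of_real t * f z)
            = J (F n) + t\<^sup>2 * (ip_norm ip f)\<^sup>2 + 2 * t * Re (ip (F n) f) - 2 * t * Re (L f)"
          unfolding J_def ip_norm_add_real_scale_sq[OF FH f] add[OF FH scale_mem[OF f]] scale[OF f]
          by simp
        then show ?thesis
          using m_le[OF add_mem[OF FH scale_mem[OF f, of t]], of n] FJ[of n]
          by (simp add: algebra_simps)
      qed
      moreover have "(\<lambda>n. (ip_norm ip f)\<^sup>2 * t\<^sup>2 + 2 * (Re (ip (F n) f) - Re (L f)) * t + 1 / real (Suc n))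
          \<longlonglongrightarrow> (ip_norm ip f)\<^sup>2 * t\<^sup>2 + 2 * (Re (ip u f) - Re (L f)) * t + 0"
        by (intro tendsto_intros conv LIMSEQ_Suc[OF lim_1_over_n])
      ultimately show "0 \<le> (ip_norm ip f)\<^sup>2 * t\<^sup>2 + 2 * (Re (ip u f) - Re (L f)) * t + 0"
        by (intro LIMSEQ_le_const) auto
    qed simp
    then show ?thesis using Re_ip_commute[OF f u] by simp
  qed
  have "ip f u = L f" if f: "f \<in> H" for f
  proof (rule complex_eqI)
    show "Re (ip f u) = Re (L f)" by (rule Re_eq[OF f])
    \<comment> \<open>Multiplication by \<open>- \<i>\<close> turns imaginary parts into real
      parts.\<close>
    show "Im (ip f u) = Im (L f)"
      using Re_eq[OF scale_mem[OF f, of "- \<i>"]] ip_scale[OF f u, of "- \<i>"] scale[OF f, of "- \<i>"]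
      by simp
  qed
  with u show thesis by (rule that)
qed

end

subsection \<open>Carleson measures\<close>

context analytic_rkhs
begin

abbreviation kernel_at :: "complex \<Rightarrow> complex \<Rightarrow> complex" where
  "kernel_at w \<equiv> (\<lambda>z. if z \<in> unit_disk then k z w else 0)"

text \<open>By the reproducing property both values are inner products of the same two kernel
  functions, in opposite order.\<close>

lemma kernel_commute:
  assumes z: "z \<in> unit_disk" and w: "w \<in> unit_disk"
  shows "k z w = cnj (k w z)"
  using reproducing[OF kernel_mem[OF w] z] reproducing[OF kernel_mem[OF z] w]
    ip_commute[OF kernel_mem[OF z] kernel_mem[OF w]] z w by simp

lemma norm_eval_le:
  assumes f: "f \<in> H" and w: "w \<in> unit_disk"
  shows "cmod (f w) \<le> ip_norm ip f * ip_norm ip (kernel_at w)"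
  using ip_Cauchy_Schwarz[OF f kernel_mem[OF w]] reproducing[OF f w] by simp

context
  fixes \<mu> :: "complex measure"
  assumes sets_mu: "sets \<mu> = sets (restrict_space borel unit_disk)"
begin

lemma space_mu: "space \<mu> = unit_disk"
  using sets_eq_imp_space_eq[OF sets_mu] by (simp add: space_restrict_space)

lemma measurable_mem: "f \<in> H \<Longrightarrow> f \<in> borel_measurable \<mu>"
  unfolding measurable_cong_sets[OF sets_mu refl]
  by (intro borel_measurable_continuous_on_restrict holomorphic_on_imp_continuous_on analytic)

text \<open>The representing element \<open>u\<close> plays the role of the adjoint embedding
  applied to \<open>f\<close>. Testing it against \<open>kernel_at z\<close> and using the Hermitian
  symmetry of \<open>k\<close> identifies \<open>u z\<close> with the integral over
  \<open>f w * k z w\<close>.\<close>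

lemma integral_op_representation:
  assumes int: "\<And>h. h \<in> H \<Longrightarrow> integrable \<mu> (\<lambda>w. h w * cnj (f w))"
    and bound: "\<And>h. h \<in> H \<Longrightarrow> cmod (\<integral>w. h w * cnj (f w) \<partial>\<mu>) \<le> C * ip_norm ip h"
  obtains u where "u \<in> H" "\<And>z. z \<in> unit_disk \<Longrightarrow> integrable \<mu> (\<lambda>w. f w * k z w)"
    "\<And>z. z \<in> unit_disk \<Longrightarrow> u z = integral_op \<mu> k f z"
    "\<And>h. h \<in> H \<Longrightarrow> ip h u = (\<integral>w. h w * cnj (f w) \<partial>\<mu>)"
proof -
  obtain u where u: "u \<in> H" and rep: "\<And>h. h \<in> H \<Longrightarrow> ip h u = (\<integral>w. h w * cnj (f w) \<partial>\<mu>)"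
  proof (rule Riesz_representation[of "\<lambda>h. \<integral>w. h w * cnj (f w) \<partial>\<mu>" C])
    show "(\<integral>w. (g w + h w) * cnj (f w) \<partial>\<mu>) = (\<integral>w. g w * cnj (f w) \<partial>\<mu>) + (\<integral>w. h w * cnj (f w) \<partial>\<mu>)"
      if "g \<in> H" "h \<in> H" for g h
      using int[OF that(1)] int[OF that(2)] by (simp add: distrib_right)
    show "(\<integral>w. (c * g w) * cnj (f w) \<partial>\<mu>) = c * (\<integral>w. g w * cnj (f w) \<partial>\<mu>)" for g c
      by (simp add: mult.assoc)
  qed (use bound in auto)
  have eq: "cnj (kernel_at z w * cnj (f w)) = f w * k z w" if "z \<in> unit_disk" "w \<in> space \<mu>" for z w
    using that kernel_commute[of z w] by (simp add: space_mu)
  have "integrable \<mu> (\<lambda>w. f w * k z w)" if z: "z \<in> unit_disk" for z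
    using integrable_cnj[OF int[OF kernel_mem[OF z]]]
    by (subst Bochner_Integration.integrable_cong[OF refl eq[OF z, symmetric]])
  moreover have "u z = integral_op \<mu> k f z" if z: "z \<in> unit_disk" for z
  proof -
    have "u z = cnj (\<integral>w. kernel_at z w * cnj (f w) \<partial>\<mu>)"
      using reproducing[OF u z] ip_commute[OF kernel_mem[OF z] u] rep[OF kernel_mem[OF z]] by simp
    also have "\<dots> = (\<integral>w. cnj (kernel_at z w * cnj (f w)) \<partial>\<mu>)"
      by (rule Bochner_Integration.integral_cnj[symmetric])
    also have "\<dots> = integral_op \<mu> k f z"
      unfolding integral_op_def by (rule Bochner_Integration.integral_cong[OF refl eq[OF z]])
    finally show ?thesis .
  qed
  ultimately show thesis using u rep that by blast
qed

text \<open>The Carleson constant enters twice: testing \<open>u\<close> against itself bounds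
  \<open>ip_norm ip u\<close> by \<open>c * L2_norm \<mu> f\<close>, and embedding \<open>u\<close>
  into \<open>L2 \<mu>\<close> costs a second factor \<open>c\<close>.\<close>

lemma carleson_imp_bounded:
  assumes "0 \<le> c"
    and mem: "\<And>h. h \<in> H \<Longrightarrow> h \<in> L2 \<mu>"
    and carleson: "\<And>h. h \<in> H \<Longrightarrow> L2_norm \<mu> h \<le> c * ip_norm ip h"
  shows "integral_op_bounded \<mu> k" and "L2_opnorm \<mu> (integral_op \<mu> k) \<le> c\<^sup>2"
proof -
  have *: "(\<forall>z\<in>space \<mu>. integrable \<mu> (\<lambda>w. f w * k z w)) \<and> integral_op \<mu> k f \<in> L2 \<mu> \<and>
      L2_norm \<mu> (integral_op \<mu> k f) \<le> c\<^sup>2 * L2_norm \<mu> f" if f: "f \<in> L2 \<mu>" for f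
  proof -
    have bound: "cmod (\<integral>w. h w * cnj (f w) \<partial>\<mu>) \<le> (c * L2_norm \<mu> f) * ip_norm ip h" if h: "h \<in> H" for h
    proof -
      have "cmod (\<integral>w. h w * cnj (f w) \<partial>\<mu>) \<le> L2_norm \<mu> h * L2_norm \<mu> f"
        using L2_Cauchy_Schwarz[OF mem[OF h] L2_cnj[OF f]] by (simp add: L2_norm_cnj)
      also have "\<dots> \<le> (c * ip_norm ip h) * L2_norm \<mu> f"
        by (intro mult_right_mono carleson[OF h] L2_norm_nonneg)
      finally show ?thesis by (simp add: mult_ac)
    qed
    obtain u where u: "u \<in> H"
      and int: "\<And>z. z \<in> unit_disk \<Longrightarrow> integrable \<mu> (\<lambda>w. f w * k z w)"
      and T: "\<And>z. z \<in> unit_disk \<Longrightarrow> u z = integral_op \<mu> k f z"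
      and rep: "\<And>h. h \<in> H \<Longrightarrow> ip h u = (\<integral>w. h w * cnj (f w) \<partial>\<mu>)"
      using integral_op_representation[OF L2_integrable_mult[OF mem L2_cnj[OF f]] bound] by blast
    have "(ip_norm ip u)\<^sup>2 \<le> (c * L2_norm \<mu> f) * ip_norm ip u"
      using bound[OF u] complex_Re_le_cmod[of "ip u u"] unfolding ip_norm_sq[OF u] rep[OF u]
      by linarith
    then have u_le: "ip_norm ip u \<le> c * L2_norm \<mu> f"
      using \<open>0 \<le> c\<close> L2_norm_nonneg[of \<mu> f] ip_norm_nonneg[OF u]
      by (cases "ip_norm ip u = 0") (auto simp: power2_eq_square)
    have Tu: "integral_op \<mu> k f z = u z" if "z \<in> space \<mu>" for z
      using T[of z] that by (simp add: space_mu)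
    have "L2_norm \<mu> (integral_op \<mu> k f) = L2_norm \<mu> u" by (rule L2_norm_cong[OF Tu])
    also have "\<dots> \<le> c * (c * L2_norm \<mu> f)"
      using carleson[OF u] mult_left_mono[OF u_le \<open>0 \<le> c\<close>] by linarith
    finally have "L2_norm \<mu> (integral_op \<mu> k f) \<le> c\<^sup>2 * L2_norm \<mu> f"
      by (simp add: power2_eq_square mult.assoc)
    moreover have "integral_op \<mu> k f \<in> L2 \<mu>"
      using L2_cong[of \<mu> "integral_op \<mu> k f" u, OF Tu] mem[OF u] by simp
    ultimately show ?thesis using int by (simp add: space_mu)
  qed
  show "integral_op_bounded \<mu> k" unfolding integral_op_bounded_def using * by blast
  show "L2_opnorm \<mu> (integral_op \<mu> k) \<le> c\<^sup>2"
    by (rule L2_opnorm_least) (use * in auto)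
qed

text \<open>The finite measure of \<open>E\<close> and the uniform evaluation bound on it make
  integration against \<open>p\<close> a bounded functional on \<open>H\<close> before any Carleson
  estimate is available.\<close>

lemma pairing_le_Re_opnorm:
  assumes bd: "integral_op_bounded \<mu> (Re_kernel k)"
    and E: "E \<in> sets \<mu>" "emeasure \<mu> E < \<infinity>"
    and eval: "\<And>h w. h \<in> H \<Longrightarrow> w \<in> E \<Longrightarrow> cmod (h w) \<le> B * ip_norm ip h"
    and p: "p \<in> borel_measurable \<mu>" "\<And>w. \<bar>p w\<bar> \<le> D" "\<And>w. w \<notin> E \<Longrightarrow> p w = 0"
    and h: "h \<in> H"
  shows "(cmod (\<integral>w. h w * complex_of_real (p w) \<partial>\<mu>))\<^sup>2
    \<le> L2_opnorm \<mu> (integral_op \<mu> (Re_kernel k)) * (L2_norm \<mu> (\<lambda>w. complex_of_real (p w)))\<^sup>2 * (ip_norm ip h)\<^sup>2"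
proof -
  let ?p = "\<lambda>w. complex_of_real (p w)"
  let ?R = "integral_op \<mu> (Re_kernel k)"
  let ?A = "L2_opnorm \<mu> ?R"
  note [measurable] = p(1) E(1)
  have "0 \<le> D" using p(2)[of 0] by linarith
  have p_int: "integrable \<mu> (\<lambda>w. \<bar>p w\<bar>)"
    by (rule integrableI_bounded_set[OF E(1) _ E(2), of _ D]) (use p in auto)
  have "integrable \<mu> (\<lambda>w. (cmod (?p w))\<^sup>2)"
  proof (rule integrableI_bounded_set[OF E(1) _ E(2), of _ "D\<^sup>2"])
    show "AE w in \<mu>. w \<in> E \<longrightarrow> norm ((cmod (?p w))\<^sup>2) \<le> D\<^sup>2"
      using p(2) \<open>0 \<le> D\<close> by (auto simp: abs_le_square_iff[symmetric])
  qed (use p(3) in auto)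
  then have pL2: "?p \<in> L2 \<mu>" by (simp add: L2_def)
  have le: "cmod (g w * ?p w) \<le> B * ip_norm ip g * \<bar>p w\<bar>" if g: "g \<in> H" for g w
    using eval[OF g, of w] p(3)[of w] mult_right_mono[of "cmod (g w)" "B * ip_norm ip g" "\<bar>p w\<bar>"]
    by (cases "w \<in> E") (auto simp: norm_mult)
  have int: "integrable \<mu> (\<lambda>w. g w * cnj (?p w))" if g: "g \<in> H" for g
  proof (rule Bochner_Integration.integrable_bound)
    show "integrable \<mu> (\<lambda>w. B * ip_norm ip g * \<bar>p w\<bar>)" using p_int by simp
    show "(\<lambda>w. g w * cnj (?p w)) \<in> borel_measurable \<mu>"
      using measurable_mem[OF g] by simp
    show "AE w in \<mu>. norm (g w * cnj (?p w)) \<le> norm (B * ip_norm ip g * \<bar>p w\<bar>)"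
      using le[OF g] by (auto intro: order_trans[OF _ abs_ge_self])
  qed
  \<comment> \<open>This crude constant serves only to obtain \<open>u\<close> from the Riesz
    theorem; the final estimate is free of \<open>B\<close> and \<open>D\<close>.\<close>
  have bound: "cmod (\<integral>w. g w * cnj (?p w) \<partial>\<mu>) \<le> (B * (\<integral>w. \<bar>p w\<bar> \<partial>\<mu>)) * ip_norm ip g"
    if g: "g \<in> H" for g
  proof -
    have "cmod (\<integral>w. g w * cnj (?p w) \<partial>\<mu>) \<le> (\<integral>w. cmod (g w * cnj (?p w)) \<partial>\<mu>)"
      by (rule integral_norm_bound)
    also have "\<dots> \<le> (\<integral>w. B * ip_norm ip g * \<bar>p w\<bar> \<partial>\<mu>)"
      using int[OF g] p_int le[OF g] by (intro integral_mono) auto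
    finally show ?thesis by (simp add: mult_ac)
  qed
  obtain u where u: "u \<in> H"
    and pk: "\<And>z. z \<in> unit_disk \<Longrightarrow> integrable \<mu> (\<lambda>w. ?p w * k z w)"
    and T: "\<And>z. z \<in> unit_disk \<Longrightarrow> u z = integral_op \<mu> k ?p z"
    and rep: "\<And>g. g \<in> H \<Longrightarrow> ip g u = (\<integral>w. g w * cnj (?p w) \<partial>\<mu>)"
    using integral_op_representation[OF int bound] by blast
  \<comment> \<open>As \<open>p\<close> is real, taking the real part commutes with multiplication
    by \<open>p\<close> under the integral.\<close>
  have R: "?R ?p z = complex_of_real (Re (u z))" if z: "z \<in> space \<mu>" for z
  proof -
    have z': "z \<in> unit_disk" using z by (simp add: space_mu)
    have "?R ?p z = complex_of_real (\<integral>w. Re (?p w * k z w) \<partial>\<mu>)"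
      unfolding integral_op_def Re_kernel_def by (simp flip: of_real_mult)
    also have "\<dots> = complex_of_real (Re (integral_op \<mu> k ?p z))"
      unfolding integral_op_def using integral_Re[OF pk[OF z']] by simp
    finally show ?thesis using T[OF z'] by simp
  qed
  have RL2: "?R ?p \<in> L2 \<mu>" using bd pL2 by (auto simp: integral_op_bounded_def)
  have "(ip_norm ip u)\<^sup>2 = Re (\<integral>w. u w * cnj (?p w) \<partial>\<mu>)"
    using ip_norm_sq[OF u] rep[OF u] by simp
  also have "\<dots> = (\<integral>w. Re (u w * cnj (?p w)) \<partial>\<mu>)" by (rule integral_Re[OF int[OF u], symmetric])
  also have "\<dots> = (\<integral>w. Re (?R ?p w * ?p w) \<partial>\<mu>)"
    using R by (intro Bochner_Integration.integral_cong) auto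
  also have "\<dots> = Re (\<integral>w. ?R ?p w * ?p w \<partial>\<mu>)"
    by (rule integral_Re[OF L2_integrable_mult[OF RL2 pL2]])
  also have "\<dots> \<le> L2_norm \<mu> (?R ?p) * L2_norm \<mu> ?p"
    using L2_Cauchy_Schwarz[OF RL2 pL2] complex_Re_le_cmod order_trans by blast
  also have "\<dots> \<le> (?A * L2_norm \<mu> ?p) * L2_norm \<mu> ?p"
    by (intro mult_right_mono L2_opnorm_upper[OF bd pL2] L2_norm_nonneg)
  finally have u_le: "(ip_norm ip u)\<^sup>2 \<le> ?A * (L2_norm \<mu> ?p)\<^sup>2"
    by (simp add: power2_eq_square mult.assoc)
  have "cmod (\<integral>w. h w * ?p w \<partial>\<mu>) \<le> ip_norm ip h * ip_norm ip u"
    using ip_Cauchy_Schwarz[OF h u] rep[OF h] by simp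
  then have "(cmod (\<integral>w. h w * ?p w \<partial>\<mu>))\<^sup>2 \<le> (ip_norm ip h * ip_norm ip u)\<^sup>2"
    by (intro power_mono) auto
  also have "\<dots> \<le> (?A * (L2_norm \<mu> ?p)\<^sup>2) * (ip_norm ip h)\<^sup>2"
    using mult_left_mono[OF u_le zero_le_power2[of "ip_norm ip h"]]
    by (simp add: power_mult_distrib mult_ac)
  finally show ?thesis .
qed

text \<open>Pairing \<open>h\<close> with its own truncated real part \<open>p\<close> gives an
  integral with real part \<open>?P\<close>, so the preceding bound reads
  \<open>?P * ?P \<le> ?P * (?A * (ip_norm ip h)\<^sup>2)\<close>.\<close>

lemma Re_integral_le_Re_opnorm:
  assumes bd: "integral_op_bounded \<mu> (Re_kernel k)"
    and E: "E \<in> sets \<mu>" "emeasure \<mu> E < \<infinity>"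
    and eval: "\<And>h w. h \<in> H \<Longrightarrow> w \<in> E \<Longrightarrow> cmod (h w) \<le> B * ip_norm ip h"
    and h: "h \<in> H"
  shows "integrable \<mu> (\<lambda>w. indicator E w * (Re (h w))\<^sup>2)"
    and "(\<integral>w. indicator E w * (Re (h w))\<^sup>2 \<partial>\<mu>)
      \<le> L2_opnorm \<mu> (integral_op \<mu> (Re_kernel k)) * (ip_norm ip h)\<^sup>2"
proof -
  let ?A = "L2_opnorm \<mu> (integral_op \<mu> (Re_kernel k))"
  define p where "p w = indicator E w * Re (h w)" for w
  \<comment> \<open>The absolute value makes \<open>D\<close> a bound for \<open>p\<close> also off
    \<open>E\<close>, where \<open>p\<close> vanishes.\<close>
  define D where "D = \<bar>B * ip_norm ip h\<bar>"
  note [measurable] = measurable_mem[OF h] E(1)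
  have p_meas [measurable]: "p \<in> borel_measurable \<mu>" unfolding p_def by measurable
  have p_le: "\<bar>p w\<bar> \<le> D" for w
    using eval[OF h, of w] abs_Re_le_cmod[of "h w"] unfolding p_def D_def
    by (cases "w \<in> E") auto
  have p_sq: "(p w)\<^sup>2 = indicator E w * (Re (h w))\<^sup>2" for w
    by (simp add: p_def power_mult_distrib indicator_def)
  have p_out: "w \<notin> E \<Longrightarrow> p w = 0" for w by (simp add: p_def)
  let ?P = "\<integral>w. (p w)\<^sup>2 \<partial>\<mu>"
  have "integrable \<mu> (\<lambda>w. (p w)\<^sup>2)"
  proof (rule integrableI_bounded_set[OF E(1) _ E(2), of _ "D\<^sup>2"])
    show "AE w in \<mu>. w \<in> E \<longrightarrow> norm ((p w)\<^sup>2) \<le> D\<^sup>2"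
      using p_le by (auto simp: abs_le_square_iff[symmetric] D_def)
  qed (auto simp: p_out)
  then show "integrable \<mu> (\<lambda>w. indicator E w * (Re (h w))\<^sup>2)" by (simp add: p_sq)
  have hp_int: "integrable \<mu> (\<lambda>w. h w * complex_of_real (p w))"
  proof (rule integrableI_bounded_set[OF E(1) _ E(2), of _ "D * D"])
    show "AE w in \<mu>. w \<in> E \<longrightarrow> norm (h w * complex_of_real (p w)) \<le> D * D"
    proof (intro AE_I2 impI)
      fix w assume "w \<in> E"
      then have "cmod (h w) \<le> D" using eval[OF h] by (fastforce simp: D_def)
      then show "norm (h w * complex_of_real (p w)) \<le> D * D"
        using p_le[of w] by (simp add: norm_mult mult_mono')
    qed
  qed (auto simp: p_out)
  have "?P = (\<integral>w. Re (h w * complex_of_real (p w)) \<partial>\<mu>)"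
    by (intro Bochner_Integration.integral_cong) (auto simp: p_def power2_eq_square indicator_def)
  also have "\<dots> = Re (\<integral>w. h w * complex_of_real (p w) \<partial>\<mu>)" by (rule integral_Re[OF hp_int])
  finally have "?P \<le> cmod (\<integral>w. h w * complex_of_real (p w) \<partial>\<mu>)"
    using complex_Re_le_cmod by metis
  then have "?P\<^sup>2 \<le> (cmod (\<integral>w. h w * complex_of_real (p w) \<partial>\<mu>))\<^sup>2"
    by (intro power_mono) auto
  also have "\<dots> \<le> ?A * (L2_norm \<mu> (\<lambda>w. complex_of_real (p w)))\<^sup>2 * (ip_norm ip h)\<^sup>2"
    using pairing_le_Re_opnorm[OF bd E eval p_meas p_le p_out h] by blast
  also have "\<dots> = ?P * (?A * (ip_norm ip h)\<^sup>2)" by (simp add: L2_norm_sq)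
  finally have "?P * ?P \<le> ?P * (?A * (ip_norm ip h)\<^sup>2)" by (simp add: power2_eq_square)
  moreover have "0 \<le> ?P" by simp
  moreover have "0 \<le> ?A * (ip_norm ip h)\<^sup>2" using L2_opnorm_nonneg[OF bd] by simp
  \<comment> \<open>Cancel \<open>?P\<close> if it is positive; if it is 0, the right-hand side is
    nonnegative anyway.\<close>
  ultimately have "?P \<le> ?A * (ip_norm ip h)\<^sup>2"
    by (metis linorder_not_less mult_le_cancel_left order_le_less)
  then show "(\<integral>w. indicator E w * (Re (h w))\<^sup>2 \<partial>\<mu>) \<le> ?A * (ip_norm ip h)\<^sup>2" by (simp add: p_sq)
qed

text \<open>The function \<open>- \<i> * h z\<close> has real part \<open>Im (h z)\<close> and the
  same norm as \<open>h\<close>; adding the two real-part estimates produces the factor 2. The bound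
  does not depend on \<open>E\<close>, which prepares monotone convergence.\<close>

lemma nn_integral_le_Re_opnorm:
  assumes bd: "integral_op_bounded \<mu> (Re_kernel k)"
    and E: "E \<in> sets \<mu>" "emeasure \<mu> E < \<infinity>"
    and eval: "\<And>h w. h \<in> H \<Longrightarrow> w \<in> E \<Longrightarrow> cmod (h w) \<le> B * ip_norm ip h"
    and h: "h \<in> H"
  shows "(\<integral>\<^sup>+w. ennreal (indicator E w * (cmod (h w))\<^sup>2) \<partial>\<mu>)
    \<le> ennreal (2 * L2_opnorm \<mu> (integral_op \<mu> (Re_kernel k)) * (ip_norm ip h)\<^sup>2)"
proof -
  let ?A = "L2_opnorm \<mu> (integral_op \<mu> (Re_kernel k))"
  have ih: "(\<lambda>z. - \<i> * h z) \<in> H" by (rule scale_mem[OF h])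
  note re = Re_integral_le_Re_opnorm[OF bd E eval h]
  note im = Re_integral_le_Re_opnorm[OF bd E eval ih]
  have im': "integrable \<mu> (\<lambda>w. indicator E w * (Im (h w))\<^sup>2)"
    "(\<integral>w. indicator E w * (Im (h w))\<^sup>2 \<partial>\<mu>) \<le> ?A * (ip_norm ip h)\<^sup>2"
    using im ip_norm_scale[OF h, of "- \<i>"] by simp_all
  have split: "indicator E w * (cmod (h w))\<^sup>2 = indicator E w * (Re (h w))\<^sup>2 + indicator E w * (Im (h w))\<^sup>2"
    for w by (simp add: cmod_power2 distrib_left)
  have "(\<integral>\<^sup>+w. ennreal (indicator E w * (cmod (h w))\<^sup>2) \<partial>\<mu>)
      = ennreal (\<integral>w. indicator E w * (cmod (h w))\<^sup>2 \<partial>\<mu>)"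
    using re(1) im'(1) by (intro nn_integral_eq_integral) (simp_all add: split)
  also have "\<dots> \<le> ennreal (2 * ?A * (ip_norm ip h)\<^sup>2)"
    using re im' by (intro ennreal_leI) (simp add: split)
  finally show ?thesis .
qed

text \<open>The intersection over \<open>H\<close> may be uncountable, but its complement in the
  disk is a union of open sets, by continuity of each \<open>f\<close>.\<close>

lemma evaluation_sublevel_measurable:
  "{w \<in> unit_disk. \<forall>f\<in>H. cmod (f w) \<le> r * ip_norm ip f} \<in> sets \<mu>" (is "?S \<in> _")
proof -
  let ?U = "\<Union>f\<in>H. unit_disk \<inter> (\<lambda>w. cmod (f w)) -` {r * ip_norm ip f<..}"
  have "open ?U"
    by (intro open_UN ballI continuous_open_preimage continuous_on_norm
        holomorphic_on_imp_continuous_on analytic) auto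
  then have "unit_disk - ?U \<in> sets borel" by simp
  moreover have "?S = unit_disk - ?U" by (auto simp: not_less)
  ultimately show ?thesis
    unfolding sets_mu sets_restrict_space by (auto intro!: image_eqI[of _ _ "?S"])
qed

text \<open>The sets \<open>E n\<close> combine finite measure, from sigma-finiteness, with
  evaluation functionals of norm at most \<open>n\<close>; they increase to the whole disk.\<close>

lemma Re_bounded_imp_carleson:
  assumes sf: "sigma_finite_measure \<mu>"
    and bd: "integral_op_bounded \<mu> (Re_kernel k)"
    and h: "h \<in> H"
  shows "h \<in> L2 \<mu>"
    and "L2_norm \<mu> h \<le> sqrt (2 * L2_opnorm \<mu> (integral_op \<mu> (Re_kernel k))) * ip_norm ip h"
proof -
  let ?A = "L2_opnorm \<mu> (integral_op \<mu> (Re_kernel k))"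
  let ?b = "2 * ?A * (ip_norm ip h)\<^sup>2"
  interpret sigma_finite_measure \<mu> by (rule sf)
  obtain F :: "nat \<Rightarrow> complex set" where F: "range F \<subseteq> sets \<mu>" "(\<Union>i. F i) = space \<mu>"
    "\<And>i. emeasure \<mu> (F i) \<noteq> \<infinity>" "incseq F"
    using sigma_finite_incseq by blast
  define S where "S n = {w \<in> unit_disk. \<forall>f\<in>H. cmod (f w) \<le> real n * ip_norm ip f}" for n
  define E where "E n = F n \<inter> S n" for n
  have S_sets: "S n \<in> sets \<mu>" for n unfolding S_def by (rule evaluation_sublevel_measurable)
  have E_sets: "E n \<in> sets \<mu>" for n using F(1) S_sets by (auto simp: E_def)
  have E_fin: "emeasure \<mu> (E n) < \<infinity>" for n
  proof -
    have "emeasure \<mu> (E n) \<le> emeasure \<mu> (F n)"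
      using F(1) by (intro emeasure_mono) (auto simp: E_def)
    then show ?thesis using F(3)[of n] by (simp add: less_top top.not_eq_extremum order_le_less_trans)
  qed
  have "S m \<subseteq> S n" if "m \<le> n" for m n
  proof -
    have "real m * ip_norm ip f \<le> real n * ip_norm ip f" if "f \<in> H" for f
      using that \<open>m \<le> n\<close> by (intro mult_right_mono ip_norm_nonneg) auto
    then show ?thesis unfolding S_def by (blast intro: order_trans)
  qed
  then have E_mono: "E m \<subseteq> E n" if "m \<le> n" for m n
    using that F(4) unfolding E_def incseq_def by blast
  have E_cover: "\<exists>n. w \<in> E n" if w: "w \<in> space \<mu>" for w
  proof -
    have w': "w \<in> unit_disk" using w by (simp add: space_mu)
    obtain i where i: "w \<in> F i" using w F(2) by blast
    \<comment> \<open>Evaluation at \<open>w\<close> is bounded by the norm of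
      \<open>kernel_at w\<close>, so \<open>w\<close> lies in every \<open>S\<close> whose index
      exceeds this norm.\<close>
    obtain n where n: "ip_norm ip (kernel_at w) \<le> real n" using real_arch_simple by blast
    let ?N = "max i n"
    have "cmod (f w) \<le> real ?N * ip_norm ip f" if f: "f \<in> H" for f
    proof -
      have "cmod (f w) \<le> ip_norm ip f * ip_norm ip (kernel_at w)" by (rule norm_eval_le[OF f w'])
      also have "\<dots> \<le> ip_norm ip f * real ?N"
        using n by (intro mult_left_mono ip_norm_nonneg f) auto
      finally show ?thesis by (simp add: mult.commute)
    qed
    then have "w \<in> S ?N" using w' by (simp add: S_def)
    moreover have "w \<in> F ?N" using i F(4) unfolding incseq_def by (meson max.cobounded1 subsetD)
    ultimately show ?thesis by (auto simp: E_def)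
  qed
  note [measurable] = measurable_mem[OF h] E_sets
  let ?g = "\<lambda>n w. ennreal (indicator (E n) w * (cmod (h w))\<^sup>2)"
  have sup: "(SUP n. ?g n w) = ennreal ((cmod (h w))\<^sup>2)" if w: "w \<in> space \<mu>" for w
  proof (rule antisym)
    show "(SUP n. ?g n w) \<le> ennreal ((cmod (h w))\<^sup>2)"
      by (intro SUP_least ennreal_leI) (simp add: indicator_def)
    obtain n where "w \<in> E n" using E_cover[OF w] by blast
    then show "ennreal ((cmod (h w))\<^sup>2) \<le> (SUP n. ?g n w)"
      by (intro SUP_upper2[of n]) auto
  qed
  have "(\<integral>\<^sup>+w. ennreal ((cmod (h w))\<^sup>2) \<partial>\<mu>) = (\<integral>\<^sup>+w. (SUP n. ?g n w) \<partial>\<mu>)"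
    using sup by (intro nn_integral_cong) simp
  also have "\<dots> = (SUP n. \<integral>\<^sup>+w. ?g n w \<partial>\<mu>)"
  proof (rule nn_integral_monotone_convergence_SUP)
    show "incseq ?g"
      using E_mono[OF le_SucI[OF order_refl]]
      by (intro incseq_SucI le_funI ennreal_leI mult_right_mono) (auto simp: indicator_def)
  qed measurable
  also have "\<dots> \<le> ennreal ?b"
  proof (rule SUP_least)
    show "(\<integral>\<^sup>+w. ?g n w \<partial>\<mu>) \<le> ennreal ?b" for n
      by (rule nn_integral_le_Re_opnorm[OF bd E_sets E_fin _ h, of n "real n"])
        (auto simp: E_def S_def)
  qed
  finally have le: "(\<integral>\<^sup>+w. ennreal ((cmod (h w))\<^sup>2) \<partial>\<mu>) \<le> ennreal ?b" .
  have int: "integrable \<mu> (\<lambda>w. (cmod (h w))\<^sup>2)"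
    using le by (intro integrableI_nonneg) (auto simp: order_le_less_trans)
  then show "h \<in> L2 \<mu>" using measurable_mem[OF h] by (simp add: L2_def)
  have "0 \<le> ?b" using L2_opnorm_nonneg[OF bd] by simp
  then have "(\<integral>w. (cmod (h w))\<^sup>2 \<partial>\<mu>) \<le> ?b"
    using le nn_integral_eq_integral[OF int] by simp
  then have "L2_norm \<mu> h \<le> sqrt ?b" unfolding L2_norm_def by (rule real_sqrt_le_mono)
  then show "L2_norm \<mu> h \<le> sqrt (2 * ?A) * ip_norm ip h"
    by (simp add: real_sqrt_mult ip_norm_nonneg[OF h])
qed

end

end

theorem lemma2:
  fixes \<mu> :: "complex measure"
    and H :: "(complex \<Rightarrow> complex) set"
    and ip :: "(complex \<Rightarrow> complex) \<Rightarrow> (complex \<Rightarrow> complex) \<Rightarrow> complex"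
    and k :: "complex \<Rightarrow> complex \<Rightarrow> complex"
  assumes "sets \<mu> = sets (restrict_space borel unit_disk)"
    and "sigma_finite_measure \<mu>"
    and "analytic_rkhs H ip k"
    and "\<And>z. z \<in> unit_disk \<Longrightarrow>
           \<exists>g. continuous_on (cball 0 1) g \<and> (\<forall>w\<in>unit_disk. g w = k z w)"
  shows "(integral_op_bounded \<mu> (Re_kernel k) \<longleftrightarrow> integral_op_bounded \<mu> k) \<and>
         (integral_op_bounded \<mu> k \<longleftrightarrow> carleson_measure H ip \<mu>) \<and>
         (integral_op_bounded \<mu> k \<longrightarrow>
           L2_opnorm \<mu> (integral_op \<mu> (Re_kernel k)) \<le> L2_opnorm \<mu> (integral_op \<mu> k) \<and>
           L2_opnorm \<mu> (integral_op \<mu> k) \<le> 2 * L2_opnorm \<mu> (integral_op \<mu> (Re_kernel k)))"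
proof -
  interpret analytic_rkhs H ip k by (rule assms(3))
  note sets = assms(1) and sf = assms(2)
  let ?A = "L2_opnorm \<mu> (integral_op \<mu> (Re_kernel k))"
  have carleson: "integral_op_bounded \<mu> (Re_kernel k) \<Longrightarrow> carleson_measure H ip \<mu>"
    unfolding carleson_measure_def using Re_bounded_imp_carleson[OF sets sf] by blast
  have bounded: "integral_op_bounded \<mu> k" if "carleson_measure H ip \<mu>"
  proof -
    obtain c where c: "\<And>f. f \<in> H \<Longrightarrow> f \<in> L2 \<mu>" "\<And>f. f \<in> H \<Longrightarrow> L2_norm \<mu> f \<le> c * ip_norm ip f"
      using \<open>carleson_measure H ip \<mu>\<close> unfolding carleson_measure_def by blast
    \<comment> \<open>\<open>carleson_measure\<close> allows a negative constant, whereas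
      \<open>carleson_imp_bounded\<close> takes a nonnegative one.\<close>
    have "L2_norm \<mu> f \<le> \<bar>c\<bar> * ip_norm ip f" if "f \<in> H" for f
      using c(2)[OF that] mult_right_mono[OF abs_ge_self[of c] ip_norm_nonneg[OF that]] by linarith
    then show ?thesis by (intro carleson_imp_bounded(1)[OF sets abs_ge_zero c(1)])
  qed
  \<comment> \<open>The embedding constant is \<open>sqrt (2 * ?A)\<close>, whose square is the
    claimed bound because \<open>?A\<close> is nonnegative.\<close>
  have upper: "L2_opnorm \<mu> (integral_op \<mu> k) \<le> 2 * ?A" if "integral_op_bounded \<mu> k"
  proof -
    have Re_bd: "integral_op_bounded \<mu> (Re_kernel k)" by (rule integral_op_bounded_Re[OF that])
    then have "0 \<le> 2 * ?A" using L2_opnorm_nonneg by simp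
    then show ?thesis
      using carleson_imp_bounded(2)[OF sets _ Re_bounded_imp_carleson[OF sets sf Re_bd]] by simp
  qed
  \<comment> \<open>The implications close the cycle (a) to (c) to (b) to (a).\<close>
  show ?thesis
    using carleson bounded upper integral_op_bounded_Re L2_opnorm_Re_le by blast
qed

end
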